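(* There exists an absolute constant $c_1>0$ such that for every $n\ge 2$, the total perimeter of any $n$ pairwise disjoint disks lying in the unit square $U=[0,1]^2$ and touching the boundary of $U$ is at most $c_1\log n$. Apart from the constant factor this bound is the best possible: there exists an absolute constant $c_2>0$ such that for every $n\ge 2$ there are $n$ pairwise disjoint disks lying in $U$, each touching the boundary of $U$, whose total perimeter is at least $c_2\log n$.
   Context: Disks are closed circular disks of positive radius. A disk contained in $U$ touches the boundary of $U$ if it intersects $\partial U$. The perimeter of a disk of radius $r$ is $2\pi r$, and the total perimeter of a family of disks is the sum of their perimeters. $\log$ denotes the logarithm to base 2. *)

theory Defs
  imports "HOL-Analysis.Analysis"
begin

definition unit_square :: "(real \<times> real) set" where
  "unit_square = {0..1} \<times> {0..1}"

definition touches_boundary :: "(real \<times> real) set \<Rightarrow> (real \<times> real) set \<Rightarrow> bool" where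
  "touches_boundary D U \<longleftrightarrow> D \<inter> frontier U \<noteq> {}"

text \<open>
  A family of \<open>n\<close> disks is given by centers \<open>c i\<close> and radii \<open>r i\<close> for \<open>i < n\<close>.
  The metric on \<^typ>\<open>real \<times> real\<close> is Euclidean, so \<^term>\<open>cball (c i) (r i)\<close> is a round disk.
  Pairwise disjointness of these nonempty sets forces the \<open>n\<close> disks to be distinct.
\<close>

definition disjoint_touching_disks ::
    "(real \<times> real) set \<Rightarrow> nat \<Rightarrow> (nat \<Rightarrow> real \<times> real) \<Rightarrow> (nat \<Rightarrow> real) \<Rightarrow> bool" where
  "disjoint_touching_disks U n c r \<longleftrightarrow>
     (\<forall>i<n. r i > 0 \<and> cball (c i) (r i) \<subseteq> U \<and> touches_boundary (cball (c i) (r i)) U) \<and>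
     disjoint_family_on (\<lambda>i. cball (c i) (r i)) {..<n}"

definition total_perimeter :: "nat \<Rightarrow> (nat \<Rightarrow> real) \<Rightarrow> real" where
  "total_perimeter n r = (\<Sum>i<n. 2 * pi * r i)"

end

theory Submission
  imports Defs "HOL-Library.Discrete_Functions" "HOL-Number_Theory.Totient"
begin

text \<open>
  Two disks touching the same side are disjoint iff the distance of their tangency points exceeds
  \<open>2 * sqrt (r * s)\<close>. Hence the disks at one side with radii in \<open>(2 ^ -(k + 1), 2 ^ -k]\<close> have tangency
  points \<open>2 ^ -k\<close> apart, so their radii sum to at most 2; about \<open>log n\<close> such scales cover all radii
  above \<open>1 / n\<close>, and the smaller disks contribute at most 1.

  Conversely, shrunken Ford circles (radius \<open>1 / (8 * q\<^sup>2)\<close> over each reduced fraction \<open>p / q\<close>) with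
  \<open>q \<le> sqrt n\<close> are at most \<open>n\<close> disjoint disks, and their radii sum to
  \<open>(\<Sum>q. totient q / (8 * q\<^sup>2))\<close>, which is of order \<open>log n\<close>.
\<close>

section \<open>The upper bound\<close>

text \<open>Pigeonhole: each cell \<open>[m * d, (m + 1) * d)\<close> contains at most one of the
  points, and \<open>\<lfloor>1 / d\<rfloor> + 1\<close> cells cover the unit interval.\<close>

lemma card_separated_le:
  fixes u :: "'a \<Rightarrow> real"
  assumes d: "d > 0"
    and range: "\<And>i. i \<in> I \<Longrightarrow> 0 \<le> u i \<and> u i \<le> 1"
    and sep: "\<And>i j. i \<in> I \<Longrightarrow> j \<in> I \<Longrightarrow> i \<noteq> j \<Longrightarrow> d \<le> \<bar>u i - u j\<bar>"
  shows "real (card I) \<le> 1 / d + 1"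
proof -
  have inj: "inj_on (\<lambda>i. \<lfloor>u i / d\<rfloor>) I"
  proof (rule inj_onI, rule ccontr)
    fix i j assume ij: "i \<in> I" "j \<in> I" and eq: "\<lfloor>u i / d\<rfloor> = \<lfloor>u j / d\<rfloor>" and "i \<noteq> j"
    have "\<bar>u i / d - u j / d\<bar> < 1" using eq by linarith
    then have "\<bar>u i - u j\<bar> / d < 1"
      using d by (simp add: diff_divide_distrib[symmetric] abs_divide)
    then show False using sep[OF ij \<open>i \<noteq> j\<close>] d by (simp add: field_simps)
  qed
  have sub: "(\<lambda>i. \<lfloor>u i / d\<rfloor>) ` I \<subseteq> {0..\<lfloor>1 / d\<rfloor>}"
  proof (rule image_subsetI)
    fix i assume "i \<in> I"
    then have "0 \<le> u i / d" "u i / d \<le> 1 / d" using range d by (auto simp: divide_right_mono)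
    then show "\<lfloor>u i / d\<rfloor> \<in> {0..\<lfloor>1 / d\<rfloor>}" by (simp add: floor_mono)
  qed
  have "card I \<le> card {0..\<lfloor>1 / d\<rfloor>}"
    using card_inj_on_le[OF inj sub] by simp
  moreover have "0 \<le> \<lfloor>1 / d\<rfloor>" using d by simp
  ultimately have "int (card I) \<le> \<lfloor>1 / d\<rfloor> + 1" unfolding card_atLeastAtMost_int by linarith
  then show ?thesis by linarith
qed

text \<open>Here \<open>u\<close> is the position of the tangency point along one side. The number
  of disks matters only for the remainder below scale \<open>1 / 2 ^ K\<close>; each of the
  \<open>K\<close> dyadic classes above it is bounded by packing alone.\<close>

lemma sum_separated_le:
  fixes u r :: "'a \<Rightarrow> real"
  assumes fin: "finite I" and card: "card I \<le> 2 ^ K"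
    and range: "\<And>i. i \<in> I \<Longrightarrow> 0 \<le> u i \<and> u i \<le> 1"
    and r: "\<And>i. i \<in> I \<Longrightarrow> 0 < r i \<and> r i \<le> 1"
    and sep: "\<And>i j. i \<in> I \<Longrightarrow> j \<in> I \<Longrightarrow> i \<noteq> j \<Longrightarrow> 4 * r i * r j \<le> (u i - u j)\<^sup>2"
  shows "sum r I \<le> 1 + 2 * real K"
proof -
  define A where "A k = {i \<in> I. 1 / 2 ^ Suc k < r i \<and> r i \<le> 1 / 2 ^ k}" for k :: nat
  have A: "sum r (A k) \<le> 2" for k
  proof -
    have "1 / 2 ^ k \<le> \<bar>u i - u j\<bar>" if "i \<in> A k" "j \<in> A k" "i \<noteq> j" for i j
    proof -
      have "(1 / 2 ^ Suc k) * (1 / 2 ^ Suc k) \<le> r i * r j"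
        using that by (intro mult_mono) (auto simp: A_def)
      then have "(1 / 2 ^ k)\<^sup>2 \<le> 4 * r i * r j"
        by (simp add: power2_eq_square field_simps)
      also have "\<dots> \<le> (u i - u j)\<^sup>2" using sep that by (auto simp: A_def)
      finally show ?thesis using abs_le_square_iff[of "1 / 2 ^ k" "u i - u j"] by simp
    qed
    then have "real (card (A k)) \<le> 1 / (1 / 2 ^ k) + 1"
      by (intro card_separated_le[where u = u]) (auto simp: A_def range)
    \<comment> \<open>The extra 1 comes from both endpoints of the side being available; times the
      maximal radius it adds only \<open>1 / 2 ^ k\<close>, hence the uniform bound 2.\<close>
    then have c: "real (card (A k)) \<le> 2 ^ k + 1" by simp
    have "sum r (A k) \<le> real (card (A k)) * (1 / 2 ^ k)"
      by (rule sum_bounded_above) (simp add: A_def)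
    also have "\<dots> \<le> (2 ^ k + 1) * (1 / 2 ^ k)"
      using c by (intro mult_right_mono) auto
    also have "\<dots> \<le> 2" by (simp add: field_simps)
    finally show ?thesis .
  qed
  \<comment> \<open>Dyadic classes are peeled off from the top, each at cost at most 2.\<close>
  have small: "sum r {i \<in> I. r i \<le> 1 / 2 ^ k} + 2 * real k \<ge> sum r I" for k
  proof (induction k)
    case 0
    have "{i \<in> I. r i \<le> 1} = I" using r by auto
    then show ?case by simp
  next
    case (Suc k)
    have "{i \<in> I. r i \<le> 1 / 2 ^ k} = {i \<in> I. r i \<le> 1 / 2 ^ Suc k} \<union> A k"
    proof -
      have "(1::real) / 2 ^ Suc k \<le> 1 / 2 ^ k" by (simp add: field_simps)
      then show ?thesis unfolding A_def by (auto intro: order_trans)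
    qed
    moreover have "sum r ({i \<in> I. r i \<le> 1 / 2 ^ Suc k} \<union> A k)
        = sum r {i \<in> I. r i \<le> 1 / 2 ^ Suc k} + sum r (A k)"
      using fin by (intro sum.union_disjoint) (auto simp: A_def)
    ultimately show ?case using Suc A[of k] by simp
  qed
  have "sum r {i \<in> I. r i \<le> 1 / 2 ^ K} \<le> real (card {i \<in> I. r i \<le> 1 / 2 ^ K}) * (1 / 2 ^ K)"
    by (rule sum_bounded_above) simp
  also have "\<dots> \<le> 2 ^ K * (1 / 2 ^ K)"
  proof (rule mult_right_mono)
    have "card {i \<in> I. r i \<le> 1 / 2 ^ K} \<le> card I" using fin by (intro card_mono) auto
    then have "real (card {i \<in> I. r i \<le> 1 / 2 ^ K}) \<le> real (2 ^ K)"
      using card by linarith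
    then show "real (card {i \<in> I. r i \<le> 1 / 2 ^ K}) \<le> 2 ^ K" by simp
  qed simp
  finally show ?thesis using small[of K] by simp
qed

section \<open>Disks in the unit square\<close>

lemma frontier_unit_square: "frontier unit_square = {0..1} \<times> {0..1} - {0<..<1} \<times> {0<..<1}"
  by (simp add: frontier_def unit_square_def closure_Times interior_Times)

lemma cball_subset_unit_square_iff:
  assumes "0 < r"
  shows "cball (x, y) r \<subseteq> unit_square \<longleftrightarrow> r \<le> x \<and> x \<le> 1 - r \<and> r \<le> y \<and> y \<le> 1 - r"
proof
  assume sub: "cball (x, y) r \<subseteq> unit_square"
  have "{(x - r, y), (x + r, y), (x, y - r), (x, y + r)} \<subseteq> cball (x, y) r"
    using assms by (auto simp: dist_Pair_Pair dist_real_def)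
  with sub show "r \<le> x \<and> x \<le> 1 - r \<and> r \<le> y \<and> y \<le> 1 - r"
    unfolding unit_square_def by auto
next
  assume *: "r \<le> x \<and> x \<le> 1 - r \<and> r \<le> y \<and> y \<le> 1 - r"
  show "cball (x, y) r \<subseteq> unit_square"
  proof
    fix p assume p: "p \<in> cball (x, y) r"
    have "dist x (fst p) \<le> r" "dist y (snd p) \<le> r"
      using p dist_fst_le[of "(x, y)" p] dist_snd_le[of "(x, y)" p] by auto
    with * show "p \<in> unit_square" unfolding unit_square_def
      by (cases p) (auto simp: dist_real_def)
  qed
qed

text \<open>Containment keeps the center at distance at least \<open>r\<close> from every side, and
  a common point with a side leaves at most \<open>r\<close>.\<close>

lemma touches_boundary_unit_squareD:
  assumes "0 < r" "cball (x, y) r \<subseteq> unit_square" "touches_boundary (cball (x, y) r) unit_square"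
  shows "x = r \<or> x = 1 - r \<or> y = r \<or> y = 1 - r"
proof -
  obtain p where p: "p \<in> cball (x, y) r" "p \<in> frontier unit_square"
    using assms(3) unfolding touches_boundary_def by auto
  have "dist x (fst p) \<le> r" "dist y (snd p) \<le> r"
    using p dist_fst_le[of "(x, y)" p] dist_snd_le[of "(x, y)" p] by auto
  moreover have "fst p = 0 \<or> fst p = 1 \<or> snd p = 0 \<or> snd p = 1"
    using p(2) unfolding frontier_unit_square by (cases p) auto
  ultimately show ?thesis
    using assms(2) unfolding cball_subset_unit_square_iff[OF assms(1)] dist_real_def by linarith
qed

lemma disjoint_cballs_iff:
  fixes a b :: "'a::euclidean_space"
  assumes "0 < r" "0 < s"
  shows "cball a r \<inter> cball b s = {} \<longleftrightarrow> r + s < dist a b"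
proof
  assume disj: "cball a r \<inter> cball b s = {}"
  show "r + s < dist a b"
  proof (rule ccontr)
    assume le: "\<not> r + s < dist a b"
    \<comment> \<open>The point dividing the segment from \<open>a\<close> to \<open>b\<close> in
      the ratio \<open>r : s\<close> lies in both balls.\<close>
    define p where "p = a + (r / (r + s)) *\<^sub>R (b - a)"
    have pa: "dist a p = r / (r + s) * dist a b"
      using assms by (simp add: p_def dist_norm norm_minus_commute)
    have "b - p = (s / (r + s)) *\<^sub>R (b - a)"
    proof -
      have "b - p = (1 - r / (r + s)) *\<^sub>R (b - a)" by (simp add: p_def algebra_simps)
      also have "1 - r / (r + s) = s / (r + s)" using assms by (simp add: field_simps)
      finally show ?thesis .
    qed
    then have pb: "dist b p = s / (r + s) * dist a b"
      using assms by (simp add: dist_norm norm_minus_commute)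
    have "dist a b / (r + s) \<le> 1" using le assms by simp
    then have "r * (dist a b / (r + s)) \<le> r * 1" "s * (dist a b / (r + s)) \<le> s * 1"
      using assms by (intro mult_left_mono; simp)+
    then have "p \<in> cball a r \<inter> cball b s" using pa pb by simp
    with disj show False by auto
  qed
next
  assume "r + s < dist a b"
  then show "cball a r \<inter> cball b s = {}"
    by (auto simp: disjoint_iff) (smt (verit) dist_commute dist_triangle)
qed

text \<open>The squared form is suited to disks on a common side: there the perpendicular term is
  \<open>(r - s)\<^sup>2\<close>, and what remains is
  \<open>4 * r * s < (x - x')\<^sup>2\<close>.\<close>

lemma disjoint_disks_iff:
  assumes "0 < r" "0 < s"
  shows "cball (x, y) r \<inter> cball (x', y') s = {} \<longleftrightarrow> (r + s)\<^sup>2 < (x - x')\<^sup>2 + (y - y')\<^sup>2"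
proof -
  have "r + s < sqrt ((x - x')\<^sup>2 + (y - y')\<^sup>2) \<longleftrightarrow> (r + s)\<^sup>2 < (x - x')\<^sup>2 + (y - y')\<^sup>2"
    using real_sqrt_less_iff[of "(r + s)\<^sup>2" "(x - x')\<^sup>2 + (y - y')\<^sup>2"] assms by simp
  then show ?thesis
    using assms by (simp add: disjoint_cballs_iff dist_Pair_Pair dist_real_def)
qed

section \<open>Summation over the four sides\<close>

lemma sum_Un_le:
  fixes f :: "'a \<Rightarrow> real"
  assumes "finite A" "finite B" "\<And>i. i \<in> A \<union> B \<Longrightarrow> 0 \<le> f i"
  shows "sum f (A \<union> B) \<le> sum f A + sum f B"
  using sum.union_inter[OF assms(1,2), of f] sum_nonneg[of "A \<inter> B" f] assms(3) by auto

lemma sum_radii_le: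
  assumes disks: "disjoint_touching_disks unit_square n c r" and n: "n \<le> 2 ^ K"
  shows "(\<Sum>i<n. r i) \<le> 4 * (1 + 2 * real K)"
proof -
  define x y where "x i = fst (c i)" and "y i = snd (c i)" for i
  have c: "c i = (x i, y i)" for i by (simp add: x_def y_def)
  have r: "0 < r i" and sub: "cball (x i, y i) (r i) \<subseteq> unit_square"
    and touch: "touches_boundary (cball (x i, y i) (r i)) unit_square" if "i < n" for i
    using disks that unfolding disjoint_touching_disks_def c by auto
  have box: "r i \<le> x i \<and> x i \<le> 1 - r i \<and> r i \<le> y i \<and> y i \<le> 1 - r i" if "i < n" for i
    using sub[OF that] cball_subset_unit_square_iff[OF r[OF that]] by blast
  have disj: "(r i + r j)\<^sup>2 < (x i - x j)\<^sup>2 + (y i - y j)\<^sup>2" if "i < n" "j < n" "i \<noteq> j" for i j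
  proof -
    have "cball (x i, y i) (r i) \<inter> cball (x j, y j) (r j) = {}"
      using disks that unfolding disjoint_touching_disks_def c disjoint_family_on_def by auto
    then show ?thesis using disjoint_disks_iff[OF r r] that by blast
  qed
  \<comment> \<open>One argument for all four sides: \<open>P\<close> selects the disks at a side,
    \<open>u\<close> is the coordinate along it and \<open>v\<close> the one across it, which equals
    \<open>r i\<close> or \<open>1 - r i\<close> throughout the side.\<close>
  have side: "sum r {i \<in> {..<n}. P i} \<le> 1 + 2 * real K"
    if u: "\<And>i. i < n \<Longrightarrow> 0 \<le> u i \<and> u i \<le> 1"
      and disj': "\<And>i j. i < n \<Longrightarrow> j < n \<Longrightarrow> i \<noteq> j \<Longrightarrow> (r i + r j)\<^sup>2 < (u i - u j)\<^sup>2 + (v i - v j)\<^sup>2"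
      and v: "\<And>i j. P i \<Longrightarrow> P j \<Longrightarrow> (v i - v j)\<^sup>2 = (r i - r j)\<^sup>2"
    for P and u v :: "nat \<Rightarrow> real"
  proof (rule sum_separated_le[where u = u])
    have "card {i \<in> {..<n}. P i} \<le> card {..<n}" by (rule card_mono) auto
    then show "card {i \<in> {..<n}. P i} \<le> 2 ^ K" using n by simp
    show "0 < r i \<and> r i \<le> 1" if "i \<in> {i \<in> {..<n}. P i}" for i
      using that r[of i] box[of i] by auto
    show "4 * r i * r j \<le> (u i - u j)\<^sup>2"
      if "i \<in> {i \<in> {..<n}. P i}" "j \<in> {i \<in> {..<n}. P i}" "i \<noteq> j" for i j
    proof -
      have "(r i + r j)\<^sup>2 < (u i - u j)\<^sup>2 + (r i - r j)\<^sup>2"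
        using disj'[of i j] v[of i j] that by auto
      then show ?thesis by (simp add: power2_eq_square algebra_simps)
    qed
  qed (use u in auto)
  let ?A = "{i \<in> {..<n}. x i = r i}" and ?B = "{i \<in> {..<n}. x i = 1 - r i}"
  let ?C = "{i \<in> {..<n}. y i = r i}" and ?D = "{i \<in> {..<n}. y i = 1 - r i}"
  have unit: "0 \<le> x i \<and> x i \<le> 1" "0 \<le> y i \<and> y i \<le> 1" if "i < n" for i
    using box[OF that] r[OF that] by auto
  have disj_swap: "(r i + r j)\<^sup>2 < (y i - y j)\<^sup>2 + (x i - x j)\<^sup>2"
    if "i < n" "j < n" "i \<noteq> j" for i j
    using disj[OF that] by linarith
  have A: "sum r ?A \<le> 1 + 2 * real K"
    by (rule side[OF unit(2) disj_swap]) auto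
  have B: "sum r ?B \<le> 1 + 2 * real K"
    by (rule side[OF unit(2) disj_swap]) (auto simp: power2_commute)
  have C: "sum r ?C \<le> 1 + 2 * real K"
    by (rule side[OF unit(1) disj]) auto
  have D: "sum r ?D \<le> 1 + 2 * real K"
    by (rule side[OF unit(1) disj]) (auto simp: power2_commute)
  \<comment> \<open>A disk in a corner belongs to two classes, so this is a cover and not a
    partition.\<close>
  have "{..<n} = (?A \<union> ?B) \<union> (?C \<union> ?D)"
    using touches_boundary_unit_squareD[OF r sub touch] by auto
  then have "sum r {..<n} = sum r ((?A \<union> ?B) \<union> (?C \<union> ?D))" by (rule arg_cong)
  also have "\<dots> \<le> sum r (?A \<union> ?B) + sum r (?C \<union> ?D)"
    by (rule sum_Un_le) (auto simp: r less_imp_le)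
  also have "sum r (?A \<union> ?B) \<le> sum r ?A + sum r ?B"
    by (rule sum_Un_le) (auto simp: r less_imp_le)
  also have "sum r (?C \<union> ?D) \<le> sum r ?C + sum r ?D"
    by (rule sum_Un_le) (auto simp: r less_imp_le)
  finally show ?thesis using A B C D by simp
qed

lemma total_perimeter_le:
  assumes disks: "disjoint_touching_disks unit_square n c r" and n: "n \<ge> 2"
  shows "total_perimeter n r \<le> 40 * pi * log 2 (real n)"
proof -
  define K where "K = nat \<lceil>log 2 (real n)\<rceil>"
  have L: "1 \<le> log 2 (real n)" using n by simp
  then have K: "log 2 (real n) \<le> real K" "real K \<le> log 2 (real n) + 1"
    unfolding K_def by linarith+
  have "real n = 2 powr log 2 (real n)" using n by simp
  also have "\<dots> \<le> 2 powr real K" using K by simp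
  finally have "real n \<le> real (2 ^ K)" by (simp add: powr_realpow)
  then have "n \<le> 2 ^ K" by linarith
  from sum_radii_le[OF disks this] have "(\<Sum>i<n. r i) \<le> 4 * (1 + 2 * real K)" .
  \<comment> \<open>Rounding up gives \<open>12 + 8 * log 2 n\<close>, and the constant is absorbed
    because \<open>log 2 n \<ge> 1\<close>.\<close>
  also have "\<dots> \<le> 20 * log 2 (real n)" using K(2) L by simp
  finally have "(\<Sum>i<n. r i) \<le> 20 * log 2 (real n)" .
  then have "2 * pi * (\<Sum>i<n. r i) \<le> 2 * pi * (20 * log 2 (real n))"
    by (intro mult_left_mono) auto
  then show ?thesis unfolding total_perimeter_def by (simp add: sum_distrib_left)
qed

section \<open>The lower bound\<close>

lemma sum_inverse_squares_le: "(\<Sum>e = 1..N. 1 / (real e)\<^sup>2) \<le> 2"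
proof -
  \<comment> \<open>The subtracted term makes the induction close, by telescoping.\<close>
  have "(\<Sum>e = 1..Suc m. 1 / (real e)\<^sup>2) \<le> 2 - 1 / real (Suc m)" for m
  proof (induction m)
    case (Suc m)
    have "1 / (real (Suc (Suc m)))\<^sup>2 \<le> 1 / real (Suc m) - 1 / real (Suc (Suc m))"
      by (simp add: divide_simps power2_eq_square)
    then show ?case using Suc by simp
  qed simp
  from this[of "N - 1"] show ?thesis
    by (cases N) (auto intro: order_trans simp del: sum.cl_ivl_Suc)
qed

text \<open>Divide Gauss' identity \<open>q = (\<Sum>d | d dvd q. totient d)\<close> by \<open>q\<^sup>2\<close>, sum over \<open>q\<close>, and write
  \<open>q = d * e\<close>: the factor \<open>\<Sum> 1 / e\<^sup>2\<close> splits off.\<close>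

lemma harm_le_sum_totient: "harm N \<le> 2 * (\<Sum>d = 1..N. real (totient d) / (real d)\<^sup>2)"
proof -
  have "harm N = (\<Sum>q = 1..N. \<Sum>d | d dvd q. real (totient d) / (real q)\<^sup>2)"
    unfolding harm_def
  proof (rule sum.cong[OF refl])
    fix q :: nat assume "q \<in> {1..N}"
    have "(\<Sum>d | d dvd q. real (totient d) / (real q)\<^sup>2) = real (\<Sum>d | d dvd q. totient d) / (real q)\<^sup>2"
      by (simp add: sum_divide_distrib)
    also have "\<dots> = inverse (real q)"
      by (simp add: totient_divisor_sum power2_eq_square inverse_eq_divide)
    finally show "inverse (of_nat q) = (\<Sum>d | d dvd q. real (totient d) / (real q)\<^sup>2)" by simp
  qed
  also have "\<dots> = (\<Sum>(q, d) \<in> (SIGMA q:{1..N}. {d. d dvd q}). real (totient d) / (real q)\<^sup>2)"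
    by (rule sum.Sigma) auto
  \<comment> \<open>Dropping the constraint \<open>d * e \<le> N\<close> only adds nonnegative terms
    and makes the index set a product.\<close>
  also have "\<dots> \<le> (\<Sum>(q, d) \<in> (\<lambda>(d, e). (d * e, d)) ` ({1..N} \<times> {1..N}). real (totient d) / (real q)\<^sup>2)"
  proof (rule sum_mono2)
    show "(SIGMA q:{1..N}. {d. d dvd q}) \<subseteq> (\<lambda>(d, e). (d * e, d)) ` ({1..N} \<times> {1..N})"
    proof clarify
      fix q d :: nat assume q: "q \<in> {1..N}" and "d dvd q"
      then obtain e where e: "q = d * e" by auto
      then have "0 < d" "0 < e" using q by (auto intro!: Nat.gr0I)
      then have "d \<le> q" "e \<le> q" using e by auto
      then have "(d, e) \<in> {1..N} \<times> {1..N}" using q \<open>0 < d\<close> \<open>0 < e\<close> by auto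
      then show "(q, d) \<in> (\<lambda>(d, e). (d * e, d)) ` ({1..N} \<times> {1..N})"
        using e by (intro image_eqI[of _ _ "(d, e)"]) auto
    qed
  qed auto
  also have "\<dots> = (\<Sum>(d, e) \<in> {1..N} \<times> {1..N}. real (totient d) / (real (d * e))\<^sup>2)"
    by (subst sum.reindex) (auto simp: inj_on_def intro!: sum.cong)
  also have "\<dots> = (\<Sum>d = 1..N. \<Sum>e = 1..N. real (totient d) / (real d)\<^sup>2 * (1 / (real e)\<^sup>2))"
    by (subst sum.cartesian_product) (auto intro!: sum.cong simp: power_mult_distrib)
  also have "\<dots> = (\<Sum>d = 1..N. real (totient d) / (real d)\<^sup>2 * (\<Sum>e = 1..N. 1 / (real e)\<^sup>2))"
    by (simp add: sum_distrib_left)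
  also have "\<dots> \<le> (\<Sum>d = 1..N. real (totient d) / (real d)\<^sup>2 * 2)"
    by (intro sum_mono mult_left_mono sum_inverse_squares_le) auto
  finally show ?thesis by (simp add: sum_distrib_left sum_distrib_right mult.commute)
qed

section \<open>Ford disks\<close>

text \<open>A pair \<open>(q, p)\<close> stands for the fraction \<open>p / q\<close>. The Ford circles are halved, so that they fit
  into the square, and their radii are halved once more, which separates tangent circles.\<close>

definition ford_pairs :: "(nat \<times> nat) set" where
  "ford_pairs = (SIGMA q:{1..}. totatives q)"

definition ford_radius :: "nat \<times> nat \<Rightarrow> real" where
  "ford_radius = (\<lambda>(q, p). 1 / (8 * (real q)\<^sup>2))"

definition ford_center :: "nat \<times> nat \<Rightarrow> real \<times> real" where
  "ford_center = (\<lambda>(q, p). (1 / 4 + real p / (2 * real q), ford_radius (q, p)))"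

text \<open>The numerator \<open>p * q' - p' * q\<close> of the difference is a nonzero integer: if
  it vanished, coprimality would make \<open>q\<close> and \<open>q'\<close> divide each
  other.\<close>

lemma coprime_fractions_separated:
  fixes p q p' q' :: nat
  assumes "0 < q" "0 < q'" "coprime p q" "coprime p' q'" "(q, p) \<noteq> (q', p')"
  shows "1 / (real q * real q')\<^sup>2 \<le> (real p / real q - real p' / real q')\<^sup>2"
proof -
  have "p * q' \<noteq> p' * q"
  proof
    assume eq: "p * q' = p' * q"
    have "q dvd p * q'" unfolding eq by simp
    then have "q dvd q'" using assms(3) by (simp add: coprime_commute coprime_dvd_mult_right_iff)
    have "q' dvd p' * q" unfolding eq[symmetric] by simp
    then have "q' dvd q" using assms(4) by (simp add: coprime_commute coprime_dvd_mult_right_iff)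
    with \<open>q dvd q'\<close> have "q = q'" by (rule dvd_antisym)
    with eq assms show False by simp
  qed
  then have "1 \<le> \<bar>int p * int q' - int p' * int q\<bar>"
    by (metis abs_ge_zero diff_eq_eq add_0 of_nat_eq_iff of_nat_mult zero_less_abs_iff int_one_le_iff_zero_less)
  then have "1 \<le> (int p * int q' - int p' * int q)\<^sup>2"
    using power_mono[of 1 "\<bar>int p * int q' - int p' * int q\<bar>" 2] by simp
  then have "real_of_int 1 \<le> real_of_int ((int p * int q' - int p' * int q)\<^sup>2)"
    by (simp only: of_int_le_iff)
  then have "1 \<le> (real p * real q' - real p' * real q)\<^sup>2" by simp
  then have "1 / (real q * real q')\<^sup>2 \<le> (real p * real q' - real p' * real q)\<^sup>2 / (real q * real q')\<^sup>2"
    by (rule divide_right_mono) simp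
  also have "\<dots> = (real p / real q - real p' / real q')\<^sup>2"
    using assms by (simp add: power_divide[symmetric] diff_frac_eq)
  finally show ?thesis .
qed

lemma ford_radius_bounds:
  assumes "a \<in> ford_pairs"
  shows "0 < ford_radius a" "ford_radius a \<le> 1 / 8"
proof -
  obtain q p where a: "a = (q, p)" "1 \<le> q" using assms by (auto simp: ford_pairs_def)
  then have "1 \<le> (real q)\<^sup>2" by simp
  then show "0 < ford_radius a" "ford_radius a \<le> 1 / 8"
    using a by (auto simp: ford_radius_def field_simps)
qed

text \<open>The first coordinate of the center lies in \<open>[1/4, 3/4]\<close>, which leaves room
  for radii up to 1/8.\<close>

lemma ford_disk_subset:
  assumes "a \<in> ford_pairs"
  shows "cball (ford_center a) (ford_radius a) \<subseteq> unit_square"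
proof -
  obtain q p where a: "a = (q, p)" "1 \<le> q" "p \<le> q"
    using assms by (auto simp: ford_pairs_def in_totatives_iff)
  then have "real p / (2 * real q) \<le> 1 / 2" by (simp add: field_simps)
  moreover have "0 \<le> real p / (2 * real q)" by simp
  ultimately show ?thesis
    using ford_radius_bounds[OF assms] unfolding a(1) ford_center_def split
    by (subst cball_subset_unit_square_iff) linarith+
qed

lemma ford_disk_touches:
  assumes "a \<in> ford_pairs"
  shows "touches_boundary (cball (ford_center a) (ford_radius a)) unit_square"
proof -
  obtain q p where a: "a = (q, p)" "1 \<le> q" "p \<le> q"
    using assms by (auto simp: ford_pairs_def in_totatives_iff)
  define x where "x = 1 / 4 + real p / (2 * real q)"
  have c: "ford_center a = (x, ford_radius a)" by (simp add: a(1) ford_center_def x_def)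
  have "real p / (2 * real q) \<le> 1 / 2" using a by (simp add: field_simps)
  then have "0 \<le> x" "x \<le> 1" by (auto simp: x_def)
  then have "(x, 0) \<in> frontier unit_square" by (simp add: frontier_unit_square)
  moreover have "(x, 0) \<in> cball (ford_center a) (ford_radius a)"
    using ford_radius_bounds[OF assms] by (simp add: c dist_Pair_Pair dist_real_def)
  ultimately show ?thesis unfolding touches_boundary_def by blast
qed

lemma ford_disks_disjoint:
  assumes "a \<in> ford_pairs" "b \<in> ford_pairs" "a \<noteq> b"
  shows "cball (ford_center a) (ford_radius a) \<inter> cball (ford_center b) (ford_radius b) = {}"
proof -
  obtain q p where a: "a = (q, p)" "0 < q" "coprime p q"
    using assms(1) by (auto simp: ford_pairs_def in_totatives_iff)
  obtain q' p' where b: "b = (q', p')" "0 < q'" "coprime p' q'"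
    using assms(2) by (auto simp: ford_pairs_def in_totatives_iff)
  define x y where "x = 1 / 4 + real p / (2 * real q)" and "y = 1 / 4 + real p' / (2 * real q')"
  have "4 * ford_radius a * ford_radius b = 1 / 16 * (1 / (real q * real q')\<^sup>2)"
    by (simp add: a(1) b(1) ford_radius_def power_mult_distrib)
  \<comment> \<open>The second halving of the radii provides this factor 4; without it neighbouring
    Ford circles would give equality.\<close>
  also have "\<dots> < 1 / 4 * (1 / (real q * real q')\<^sup>2)"
    using a b by (intro mult_strict_right_mono) auto
  also have "\<dots> \<le> 1 / 4 * (real p / real q - real p' / real q')\<^sup>2"
    using coprime_fractions_separated[of q q' p p'] a b assms(3) by auto
  also have "\<dots> = (x - y)\<^sup>2"
  proof -
    have "x - y = 1 / 2 * (real p / real q - real p' / real q')" by (simp add: x_def y_def)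
    then show ?thesis by (simp only: power_mult_distrib) (simp add: power2_eq_square)
  qed
  finally have "(ford_radius a + ford_radius b)\<^sup>2 < (x - y)\<^sup>2 + (ford_radius a - ford_radius b)\<^sup>2"
    by (simp add: power2_eq_square algebra_simps)
  then show ?thesis
    using disjoint_disks_iff[OF ford_radius_bounds(1)[OF assms(1)] ford_radius_bounds(1)[OF assms(2)]]
    by (simp add: a(1) b(1) ford_center_def x_def y_def)
qed

text \<open>Supplies the spare disks that bring the family up to exactly \<open>n\<close>
  members.\<close>

lemma infinite_ford_pairs: "infinite ford_pairs"
proof -
  have "(\<lambda>q. (q, 1)) ` {1..} \<subseteq> ford_pairs" by (auto simp: ford_pairs_def in_totatives_iff)
  moreover have "infinite ((\<lambda>q. (q, 1::nat)) ` {1::nat..})"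
    by (subst finite_image_iff) (auto simp: inj_on_def infinite_Ici)
  ultimately show ?thesis using finite_subset by blast
qed

section \<open>A family with large total perimeter\<close>

lemma exists_disks:
  assumes n: "n \<ge> 2"
  shows "\<exists>c r. disjoint_touching_disks unit_square n c r \<and> pi / 16 * ln 2 * log 2 (real n) \<le> total_perimeter n r"
proof -
  define N where "N = floor_sqrt n"
  define F where "F = (SIGMA q:{1..N}. totatives q)"
  have F: "finite F" "F \<subseteq> ford_pairs" by (auto simp: F_def ford_pairs_def)
  have "F \<subseteq> {1..N} \<times> {1..N}" by (auto simp: F_def in_totatives_iff)
  then have "card F \<le> card ({1..N} \<times> {1..N})" by (intro card_mono) auto
  also have "\<dots> \<le> n" by (simp add: N_def power2_eq_square[symmetric])
  finally have cardF: "card F \<le> n" .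
  \<comment> \<open>The estimate rests on \<open>F\<close> alone; the padding \<open>T\<close> can
    be any further Ford disks, since it only increases the sum.\<close>
  have "infinite (ford_pairs - F)" using infinite_ford_pairs F by simp
  then obtain T where T: "T \<subseteq> ford_pairs - F" "finite T" "card T = n - card F"
    using infinite_arbitrarily_large by blast
  define S where "S = F \<union> T"
  have S: "finite S" "S \<subseteq> ford_pairs" "F \<subseteq> S" using F T by (auto simp: S_def)
  have "card S = n" unfolding S_def using F T cardF by (subst card_Un_disjoint) auto
  then obtain h where h: "bij_betw h {..<n} S"
    using ex_bij_betw_nat_finite[OF S(1)] by (auto simp: atLeast0LessThan)
  let ?c = "\<lambda>i. ford_center (h i)" and ?r = "\<lambda>i. ford_radius (h i)"
  have hS: "h i \<in> ford_pairs" if "i < n" for i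
    using bij_betwE[OF h] S(2) that by auto
  have h_inj: "h i \<noteq> h j" if "i < n" "j < n" "i \<noteq> j" for i j
    using h that by (auto dest!: bij_betw_imp_inj_on inj_onD)
  have "disjoint_touching_disks unit_square n ?c ?r"
    unfolding disjoint_touching_disks_def disjoint_family_on_def
  proof (intro conjI allI impI ballI)
    fix i assume "i < n"
    then show "0 < ?r i" "cball (?c i) (?r i) \<subseteq> unit_square"
      "touches_boundary (cball (?c i) (?r i)) unit_square"
      using hS ford_radius_bounds(1) ford_disk_subset ford_disk_touches by auto
  next
    fix i j assume "i \<in> {..<n}" "j \<in> {..<n}" "i \<noteq> j"
    then show "cball (?c i) (?r i) \<inter> cball (?c j) (?r j) = {}"
      using hS h_inj by (intro ford_disks_disjoint) auto
  qed
  moreover have "pi / 16 * ln 2 * log 2 (real n) \<le> total_perimeter n ?r"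
  proof -
    have "n < (Suc N)\<^sup>2" unfolding N_def by (rule Suc_floor_sqrt_power2_gt)
    then have "real n \<le> (real N + 1)\<^sup>2"
      by (metis add.commute less_imp_le of_nat_Suc of_nat_le_iff of_nat_power)
    then have "ln (real n) \<le> ln ((real N + 1)\<^sup>2)" using n by (subst ln_le_cancel_iff) auto
    also have "\<dots> = 2 * ln (real N + 1)" by (simp add: ln_realpow)
    also have "\<dots> \<le> 2 * harm N" using ln_le_harm[of N] by simp
    also have "\<dots> \<le> 4 * (\<Sum>d = 1..N. real (totient d) / (real d)\<^sup>2)"
      using harm_le_sum_totient[of N] by simp
    also have "(\<Sum>d = 1..N. real (totient d) / (real d)\<^sup>2) = 8 * sum ford_radius F"
    proof -
      have "sum ford_radius F = (\<Sum>q = 1..N. \<Sum>p\<in>totatives q. 1 / (8 * (real q)\<^sup>2))"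
        unfolding F_def ford_radius_def by (rule sum.Sigma[symmetric]) auto
      then show ?thesis by (simp add: totient_def sum_distrib_left)
    qed
    also have "sum ford_radius F \<le> sum ford_radius S"
      using S ford_radius_bounds(1) by (intro sum_mono2) (blast intro: less_imp_le)+
    also have "sum ford_radius S = (\<Sum>i<n. ?r i)"
      using sum.reindex_bij_betw[OF h, of ford_radius] by simp
    \<comment> \<open>The factor is 2 from \<open>n \<le> (N + 1)\<^sup>2\<close>, 2 from the
      inverse squares and 8 from the radii.\<close>
    finally have "ln (real n) \<le> 32 * (\<Sum>i<n. ?r i)" by simp
    then have "pi / 16 * ln (real n) \<le> pi / 16 * (32 * (\<Sum>i<n. ?r i))"
      by (intro mult_left_mono) auto
    also have "\<dots> = 2 * pi * (\<Sum>i<n. ?r i)" by simp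
    finally show ?thesis
      by (simp add: total_perimeter_def sum_distrib_left log_def)
  qed
  ultimately show ?thesis by blast
qed

theorem theorem1:
  "(\<exists>c1::real. c1 > 0 \<and>
      (\<forall>n::nat. n \<ge> 2 \<longrightarrow>
        (\<forall>(c :: nat \<Rightarrow> real \<times> real) (r :: nat \<Rightarrow> real).
           disjoint_touching_disks unit_square n c r \<longrightarrow>
           total_perimeter n r \<le> c1 * log 2 (real n)))) \<and>
   (\<exists>c2::real. c2 > 0 \<and>
      (\<forall>n::nat. n \<ge> 2 \<longrightarrow>
        (\<exists>(c :: nat \<Rightarrow> real \<times> real) (r :: nat \<Rightarrow> real).
           disjoint_touching_disks unit_square n c r \<and>
           total_perimeter n r \<ge> c2 * log 2 (real n))))"
  by (intro conjI exI[of _ "40 * pi"] exI[of _ "pi / 16 * ln 2"] allI impI total_perimeter_le exists_disks)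
    simp_all

end
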